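(* Let $\rho\geq 2$ be an integer. Then for each integer $n\geq 2$, $$\sum_{k=0}^{n-1}(4k+1)\binom{2k}{k}^\rho\cdot(-4)^{\rho(n-1-k)}\equiv 0\pmod{2^{\rho-2}\,n\binom{2n}{n}}.$$
   Context: The congruence is an ordinary congruence between integers. *)

theory Defs
  imports "HOL-Number_Theory.Cong"
begin

end

theory Submission
  imports Defs "HOL-Computational_Algebra.Formal_Power_Series"
begin

text \<open>
  Write \<open>B k\<close> for the central binomial coefficient \<open>(2 * k) choose k\<close>.  Since
  \<open>B k = (-4) ^ k * (x gchoose k)\<close> at \<open>x = -1/2\<close>, the sum is, up to a power of two and a sign,
  \<open>\<Sum>k<n. (x - 2 * k) * (x gchoose k) ^ \<rho>\<close>.  The odd part and the power of two in the modulus are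
  treated separately.

  The odd part rests on the family \<open>(k gchoose j) * (x - k gchoose j)\<close>, which is
  invariant under the reflection \<open>k \<mapsto> x - k\<close>, whereas \<open>x - 2 * k\<close> changes its sign.  Two facts
  make this family useful.
  First, \<open>(x - 2 * k) * (x gchoose k)\<close> times a member of the family has the closed partial sum
  \<open>n * (x gchoose n) * (n - 1 gchoose j) * (x - n gchoose j)\<close>
  (\<open>sum_reflection_invariant\<close>), so that the factor \<open>n * (x gchoose n)\<close> is always split off.
  Second, multiplying a member by \<open>x gchoose k\<close> gives a combination of members whose coefficients
  \<open>(x gchoose i) * (j choose i)\<close> do not depend on \<open>k\<close> and have no denominators other than
  those of \<open>x gchoose i\<close> (\<open>gbinomial_mult_reflection_invariant\<close>); hence
  \<open>(x gchoose k) ^ (\<rho> - 1)\<close> is such a combination too.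
  At \<open>x = -1/2\<close> all the coefficients are dyadic rationals, so the sum is
  \<open>n * B n\<close> times a dyadic rational, and the odd part of \<open>n * B n\<close> divides it.

  For the power of two, note \<open>n * B n = 2 * (2 * n - 1) * B (n - 1)\<close>.  If \<open>2 ^ s\<close> is the power of
  two in \<open>B (n - 1)\<close>, the modulus contains exactly \<open>2 ^ (\<rho> - 1 + s)\<close>, and \<open>s \<ge> 1\<close>
  gives \<open>\<rho> - 1 + s \<le> \<rho> * s\<close>.  Passing from \<open>B k\<close> to \<open>B (k + 1)\<close> gains at
  most one factor of two, and the powers of \<open>-4\<close> in the summands more than make up for this, so
  every single summand is divisible by \<open>2 ^ (\<rho> * s)\<close>.
\<close>

section \<open>Powers of a binomial coefficient in reflection-invariant form\<close>

text \<open>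
  After absorbing \<open>k gchoose i\<close> into the summand, the sum over \<open>j\<close> becomes a Vandermonde
  convolution with value \<open>x - i gchoose k\<close>, and the two sides are the two ways of
  writing a trinomial coefficient.  The bound \<open>m\<close> is decoupled from \<open>k\<close> so that
  the expansion can be summed over \<open>k\<close>.
\<close>

lemma gbinomial_mult_reflection_invariant:
  fixes x :: "'a::field_char_0"
  assumes "k \<le> m"
  shows "(x gchoose k) * (of_nat (k choose i) * (x - of_nat k gchoose i)) =
    (\<Sum>j\<le>m. (x gchoose i) * of_nat (j choose i) *
      (of_nat (k choose j) * (x - of_nat k gchoose j)))"
proof (cases "i \<le> k")
  case False
  have "(x gchoose i) * of_nat (j choose i) *
      (of_nat (k choose j) * (x - of_nat k gchoose j)) = 0" for j
    using False by (cases "j < i") auto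
  then show ?thesis using False by (simp only: sum.neutral_const) simp
next
  case True
  let ?y = "x - of_nat k"
  have shift: "(j choose i) * (k choose j) = (k choose i) * ((k - i) choose (k - j))"
    if "j \<le> k" for j
  proof (cases "i \<le> j")
    case True
    have "(k - i) choose (k - j) = (k - i) choose (j - i)"
      using True that binomial_symmetric[of "k - j" "k - i"] by simp
    then show ?thesis
      using choose_mult[OF True that] by (simp add: mult.commute)
  next
    case False
    then have "k - i < k - j" using \<open>i \<le> k\<close> by linarith
    then have "(k - i) choose (k - j) = 0" by (rule binomial_eq_0)
    moreover have "j choose i = 0" using False by simp
    ultimately show ?thesis by (simp only: mult_0 mult_0_right)
  qed
  have "(\<Sum>j\<le>m. of_nat (j choose i) * (of_nat (k choose j) * (?y gchoose j)))
      = (\<Sum>j\<le>k. of_nat (j choose i) * (of_nat (k choose j) * (?y gchoose j)))"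
    by (rule sum.mono_neutral_right) (use assms in auto)
  also have "\<dots> = (\<Sum>j\<le>k. of_nat (k choose i) *
      ((?y gchoose j) * (of_nat (k - i) gchoose (k - j))))"
  proof (rule sum.cong[OF refl])
    fix j assume "j \<in> {..k}"
    then have "of_nat (j choose i) * (of_nat (k choose j) :: 'a) =
        of_nat (k choose i) * of_nat ((k - i) choose (k - j))"
      using shift[of j] by (metis atMost_iff of_nat_mult)
    then show "of_nat (j choose i) * (of_nat (k choose j) * (?y gchoose j)) =
        of_nat (k choose i) * ((?y gchoose j) * (of_nat (k - i) gchoose (k - j)))"
      by (simp add: binomial_gbinomial mult_ac)
  qed
  also have "\<dots> = of_nat (k choose i) * (?y + of_nat (k - i) gchoose k)"
    by (simp add: gbinomial_Vandermonde[symmetric] sum_distrib_left atMost_atLeast0)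
  also have "?y + of_nat (k - i) = x - of_nat i"
    using True by (simp add: of_nat_diff)
  finally have inner:
    "(\<Sum>j\<le>m. of_nat (j choose i) * (of_nat (k choose j) * (?y gchoose j))) =
      of_nat (k choose i) * (x - of_nat i gchoose k)" .
  have "(x gchoose k) * (?y gchoose i) = (x gchoose (k + i)) * of_nat ((k + i) choose k)"
    using gbinomial_trinomial_revision[of k "k + i" x] by (simp add: binomial_gbinomial)
  also have "(k + i) choose k = (k + i) choose i"
    using binomial_symmetric[of k "k + i"] by simp
  also have "(x gchoose (k + i)) * of_nat ((k + i) choose i) =
      (x gchoose i) * (x - of_nat i gchoose k)"
    using gbinomial_trinomial_revision[of i "k + i" x] by (simp add: binomial_gbinomial)
  finally have trinomial:
    "(x gchoose k) * (?y gchoose i) = (x gchoose i) * (x - of_nat i gchoose k)" .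
  have "(\<Sum>j\<le>m. (x gchoose i) * of_nat (j choose i) *
      (of_nat (k choose j) * (?y gchoose j)))
      = (x gchoose i) * (of_nat (k choose i) * (x - of_nat i gchoose k))"
    unfolding inner[symmetric] by (simp add: sum_distrib_left mult.assoc)
  then show ?thesis
    using trinomial by (simp add: mult_ac)
qed

text \<open>
  The coefficients of \<open>(x gchoose k) ^ r\<close> in the reflection-invariant family: one more
  factor \<open>x gchoose k\<close> acts on the coefficient vector by the triangular matrix with entries
  \<open>(x gchoose i) * (j choose i)\<close>, which is the same for all \<open>k\<close>.
\<close>

primrec reflection_coeff :: "'a::field_char_0 \<Rightarrow> nat \<Rightarrow> nat \<Rightarrow> 'a" where
  "reflection_coeff x 0 j = (if j = 0 then 1 else 0)"
| "reflection_coeff x (Suc r) j =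
    (\<Sum>i\<le>j. reflection_coeff x r i * ((x gchoose i) * of_nat (j choose i)))"

lemma gbinomial_power_reflection_invariant:
  fixes x :: "'a::field_char_0"
  assumes "k \<le> m"
  shows "(x gchoose k) ^ r =
    (\<Sum>j\<le>m. reflection_coeff x r j * (of_nat (k choose j) * (x - of_nat k gchoose j)))"
proof (induction r)
  case 0
  have "(\<Sum>j\<le>m. reflection_coeff x 0 j * (of_nat (k choose j) * (x - of_nat k gchoose j)))
      = (\<Sum>j\<in>{0}. reflection_coeff x 0 j * (of_nat (k choose j) * (x - of_nat k gchoose j)))"
    by (rule sum.mono_neutral_right) auto
  then show ?case by simp
next
  case (Suc r)
  let ?e = "\<lambda>j. of_nat (k choose j) * (x - of_nat k gchoose j)"
  let ?d = "reflection_coeff x r"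
  have ext: "reflection_coeff x (Suc r) j =
      (\<Sum>i\<le>m. ?d i * ((x gchoose i) * of_nat (j choose i)))" if "j \<le> m" for j
    unfolding reflection_coeff.simps
    by (rule sum.mono_neutral_left) (use that in auto)
  have "(x gchoose k) ^ Suc r = (\<Sum>i\<le>m. ?d i * ((x gchoose k) * ?e i))"
    using Suc by (simp add: sum_distrib_left mult_ac)
  also have "\<dots> = (\<Sum>i\<le>m. \<Sum>j\<le>m. ?d i * ((x gchoose i) * of_nat (j choose i)) * ?e j)"
    by (simp only: gbinomial_mult_reflection_invariant[OF assms] sum_distrib_left mult.assoc)
  also have "\<dots> = (\<Sum>j\<le>m. \<Sum>i\<le>m. ?d i * ((x gchoose i) * of_nat (j choose i)) * ?e j)"
    by (rule sum.swap)
  also have "\<dots> = (\<Sum>j\<le>m. reflection_coeff x (Suc r) j * ?e j)"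
    by (rule sum.cong[OF refl], subst ext) (simp_all add: sum_distrib_right)
  finally show ?case .
qed

section \<open>The odd-weighted sum\<close>

lemma times_binomial_minus1_comp:
  "of_nat n * of_nat ((n - 1) choose j) = (of_nat n - of_nat j) * (of_nat (n choose j) :: 'a::field_char_0)"
proof (cases n)
  case 0
  then show ?thesis by (cases j) auto
next
  case (Suc m)
  show ?thesis
    using gbinomial_absorb_comp[of "of_nat n :: 'a" j] Suc by (simp add: binomial_gbinomial)
qed

text \<open>
  The summand is the forward difference of the right-hand side: the absorption identities turn
  the closed form at \<open>n + 1\<close> and at \<open>n\<close> into \<open>x - n - j\<close> and \<open>n - j\<close> times the same product, and
  these factors differ by \<open>x - 2 * n\<close>.
\<close>

lemma sum_reflection_invariant:
  fixes x :: "'a::field_char_0"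
  shows "(\<Sum>k<n. (x - 2 * of_nat k) * (x gchoose k) *
      (of_nat (k choose j) * (x - of_nat k gchoose j))) =
    of_nat n * (x gchoose n) * (of_nat ((n - 1) choose j) * (x - of_nat n gchoose j))"
proof (induction n)
  case 0
  then show ?case by simp
next
  case (Suc n)
  let ?c = "(x gchoose n) * of_nat (n choose j) * (x - of_nat n gchoose j)"
  have low: "of_nat n * (x gchoose n) * (of_nat ((n - 1) choose j) * (x - of_nat n gchoose j)) =
      (of_nat n - of_nat j) * ?c"
    using times_binomial_minus1_comp[of n j, where 'a='a] by (simp add: mult_ac)
  have up: "of_nat (Suc n) * (x gchoose Suc n) = (x - of_nat n) * (x gchoose n)"
    using gbinomial_mult_1[of x n] by (simp add: algebra_simps)
  have "(x - of_nat n) * (x - of_nat (Suc n) gchoose j) =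
      (x - of_nat n - of_nat j) * (x - of_nat n gchoose j)"
    using gbinomial_absorb_comp[of "x - of_nat n" j] by (simp add: algebra_simps)
  then have high: "of_nat (Suc n) * (x gchoose Suc n) *
      (of_nat ((Suc n - 1) choose j) * (x - of_nat (Suc n) gchoose j)) =
      (x - of_nat n - of_nat j) * ?c"
    unfolding up by (simp add: mult_ac)
  show ?case
    unfolding high using Suc low by (simp add: algebra_simps)
qed

text \<open>
  The factor \<open>n * (x gchoose n)\<close> splits off because it occurs in the partial sum for every
  \<open>j\<close>.  One of the \<open>r + 1\<close> factors \<open>x gchoose k\<close> is kept for the telescoping, and the
  other \<open>r\<close> are expanded.
\<close>

theorem sum_gbinomial_power:
  fixes x :: "'a::field_char_0"
  shows "(\<Sum>k<n. (x - 2 * of_nat k) * (x gchoose k) ^ Suc r) =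
    of_nat n * (x gchoose n) * (\<Sum>j\<le>n. reflection_coeff x r j *
      (of_nat ((n - 1) choose j) * (x - of_nat n gchoose j)))"
proof -
  let ?e = "\<lambda>k j. of_nat (k choose j) * (x - of_nat k gchoose j)"
  have "(\<Sum>k<n. (x - 2 * of_nat k) * (x gchoose k) ^ Suc r) =
      (\<Sum>k<n. \<Sum>j\<le>n. reflection_coeff x r j * ((x - 2 * of_nat k) * (x gchoose k) * ?e k j))"
  proof (rule sum.cong[OF refl])
    fix k assume "k \<in> {..<n}"
    then have "k \<le> n" by simp
    from gbinomial_power_reflection_invariant[OF this, of x r]
    show "(x - 2 * of_nat k) * (x gchoose k) ^ Suc r =
        (\<Sum>j\<le>n. reflection_coeff x r j * ((x - 2 * of_nat k) * (x gchoose k) * ?e k j))"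
      by (simp add: sum_distrib_left mult_ac)
  qed
  also have "\<dots> = (\<Sum>j\<le>n. reflection_coeff x r j *
      (\<Sum>k<n. (x - 2 * of_nat k) * (x gchoose k) * ?e k j))"
    by (subst sum.swap) (simp only: sum_distrib_left)
  also have "\<dots> = of_nat n * (x gchoose n) * (\<Sum>j\<le>n. reflection_coeff x r j *
      (of_nat ((n - 1) choose j) * (x - of_nat n gchoose j)))"
    unfolding sum_reflection_invariant by (simp add: sum_distrib_left mult_ac)
  finally show ?thesis .
qed

section \<open>Central binomial coefficients\<close>

lemma central_binomial_Suc:
  "(2 * Suc k) choose Suc k = 2 * (Suc (2 * k) choose k)"
proof -
  have "Suc k * ((2 * Suc k) choose Suc k) = (2 * Suc k) * (Suc (2 * k) choose k)"
    using Suc_times_binomial[of k "Suc (2 * k)"] by simp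
  then have "Suc k * ((2 * Suc k) choose Suc k) = Suc k * (2 * (Suc (2 * k) choose k))"
    by (simp only: mult_ac)
  then show ?thesis by (simp only: mult_cancel1) simp
qed

lemma Suc_times_central_binomial:
  "Suc k * ((2 * Suc k) choose Suc k) = 2 * (2 * k + 1) * ((2 * k) choose k)"
proof -
  have "Suc (2 * k) choose k = Suc (2 * k) choose Suc k"
    using binomial_symmetric[of k "Suc (2 * k)"] by simp
  then have "Suc k * (Suc (2 * k) choose k) = Suc (2 * k) * ((2 * k) choose k)"
    using Suc_times_binomial[of k "2 * k"] by simp
  then show ?thesis
    unfolding central_binomial_Suc by (metis Suc_eq_plus1 mult.assoc mult.left_commute)
qed

lemma central_binomial_conv_gbinomial:
  "of_nat ((2 * k) choose k) = (-4) ^ k * ((-1/2 :: 'a::field_char_0) gchoose k)"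
proof (induction k)
  case 0
  then show ?case by simp
next
  case (Suc k)
  let ?x = "-1/2 :: 'a"
  have "of_nat (Suc k) * (?x gchoose Suc k) = (?x - of_nat k) * (?x gchoose k)"
    using gbinomial_mult_1[of ?x k] by (simp add: algebra_simps)
  then have "of_nat (Suc k) * ((-4) ^ Suc k * (?x gchoose Suc k)) =
      (-4) ^ Suc k * ((?x - of_nat k) * (?x gchoose k))"
    by (metis mult.left_commute)
  also have "\<dots> = 2 * (2 * of_nat k + 1) * ((-4) ^ k * (?x gchoose k))"
    by (simp add: field_simps)
  also have "\<dots> = of_nat (Suc k) * of_nat ((2 * Suc k) choose Suc k)"
    unfolding Suc[symmetric] of_nat_mult[symmetric] Suc_times_central_binomial
    by (simp add: algebra_simps)
  finally show ?case
    by (simp only: mult_cancel_left of_nat_eq_0_iff) simp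
qed

text \<open>
  In \<open>(k + 1) * B (k + 1) = 2 * (2 * k + 1) * B k\<close> the factor \<open>2 * k + 1\<close> is odd, so going down by
  one index loses at most one factor of two.
\<close>

lemma power_two_dvd_central_binomial:
  assumes "2 ^ s dvd (2 * m) choose m" and "k \<le> m"
  shows "2 ^ s dvd 2 ^ (m - k) * ((2 * k) choose k)"
  using assms(2)
proof (induction rule: inc_induct)
  case base
  then show ?case using assms(1) by simp
next
  case (step k)
  have "2 ^ s dvd Suc k * (2 ^ (m - Suc k) * ((2 * Suc k) choose Suc k))"
    using step.IH by (rule dvd_mult)
  also have "\<dots> = (2 * k + 1) * (2 ^ Suc (m - Suc k) * ((2 * k) choose k))"
    unfolding mult.left_commute[of "Suc k"] Suc_times_central_binomial by (simp add: algebra_simps)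
  also have "Suc (m - Suc k) = m - k"
    using step.hyps by simp
  finally have "2 ^ s dvd (2 * k + 1) * (2 ^ (m - k) * ((2 * k) choose k))" .
  moreover have "coprime (2 ^ s) (2 * k + 1)"
    by simp
  ultimately show ?case
    by (simp only: coprime_dvd_mult_right_iff)
qed

section \<open>Dyadic rationals\<close>

definition dyadic :: "'a::field_char_0 \<Rightarrow> bool" where
  "dyadic x \<longleftrightarrow> (\<exists>e. 2 ^ e * x \<in> \<int>)"

lemma dyadic_of_int [simp]: "dyadic (of_int a)"
  unfolding dyadic_def by (rule exI[of _ 0]) simp

lemma dyadic_of_nat [simp]: "dyadic (of_nat a)"
  using dyadic_of_int[of "int a"] by simp

lemma dyadic_0_1 [simp]: "dyadic 0" "dyadic 1"
  using dyadic_of_nat[of 0] dyadic_of_nat[of 1] by simp_all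

lemma dyadic_mult:
  assumes "dyadic x" "dyadic y"
  shows "dyadic (x * y)"
proof -
  obtain d e where "2 ^ d * x \<in> \<int>" "2 ^ e * y \<in> \<int>"
    using assms unfolding dyadic_def by blast
  then have "(2 ^ d * x) * (2 ^ e * y) \<in> \<int>" by (rule Ints_mult)
  then have "2 ^ (d + e) * (x * y) \<in> \<int>" by (simp add: power_add mult_ac)
  then show ?thesis unfolding dyadic_def by blast
qed

lemma dyadic_add:
  assumes "dyadic x" "dyadic y"
  shows "dyadic (x + y)"
proof -
  obtain d e where "2 ^ d * x \<in> \<int>" "2 ^ e * y \<in> \<int>"
    using assms unfolding dyadic_def by blast
  then have "2 ^ e * (2 ^ d * x) + 2 ^ d * (2 ^ e * y) \<in> \<int>"
    by (metis Ints_add Ints_mult Ints_numeral Ints_power)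
  then have "2 ^ (d + e) * (x + y) \<in> \<int>" by (simp add: power_add algebra_simps)
  then show ?thesis unfolding dyadic_def by blast
qed

lemma dyadic_diff: "dyadic x \<Longrightarrow> dyadic y \<Longrightarrow> dyadic (x - y)"
  using dyadic_add[of x "of_int (-1) * y"] dyadic_mult[OF dyadic_of_int[of "-1"], of y] by simp

lemma dyadic_sum: "(\<And>i. i \<in> A \<Longrightarrow> dyadic (f i)) \<Longrightarrow> dyadic (sum f A)"
  by (induction A rule: infinite_finite_induct) (auto intro: dyadic_add)

lemma dyadic_inverse_power_two: "dyadic (1 / (-4) ^ k)"
proof -
  have "(2::'a) ^ (2 * k) = (-1) ^ k * (-4) ^ k"
    by (simp add: power_mult power_mult_distrib[symmetric])
  then have "2 ^ (2 * k) * (1 / (-4) ^ k) = ((-1) ^ k :: 'a)"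
    by simp
  also have "\<dots> \<in> \<int>" by (intro Ints_power Ints_minus) simp
  finally show ?thesis unfolding dyadic_def by blast
qed

text \<open>
  The case \<open>n = 0\<close> is the formula through central binomial coefficients, and
  Pascal's rule carries dyadicity from upper argument \<open>-1/2 - n\<close> to \<open>-1/2 - (n + 1)\<close>.
\<close>

lemma dyadic_gbinomial_half: "dyadic ((-1/2 :: 'a::field_char_0) - of_nat n gchoose j)"
proof (induction n arbitrary: j)
  case 0
  have "(-1/2 :: 'a) gchoose j = of_nat ((2 * j) choose j) * (1 / (-4) ^ j)"
    by (simp add: central_binomial_conv_gbinomial)
  then show ?case
    using dyadic_mult[OF dyadic_of_nat dyadic_inverse_power_two] by simp
next
  case (Suc n)
  note base = Suc.IH
  show ?case
  proof (induction j)
    case 0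
    then show ?case by simp
  next
    case (Suc j)
    have "(-1/2 :: 'a) - of_nat (Suc n) gchoose Suc j =
        (-1/2 - of_nat n gchoose Suc j) - (-1/2 - of_nat (Suc n) gchoose j)"
      using gbinomial_addition_formula[of "-1/2 - of_nat n :: 'a" j] by (simp add: algebra_simps)
    then show ?case
      using dyadic_diff[OF base Suc.IH] by simp
  qed
qed

lemma dyadic_reflection_coeff: "dyadic (reflection_coeff (-1/2 :: 'a::field_char_0) r j)"
proof (induction r arbitrary: j)
  case 0
  then show ?case by simp
next
  case (Suc r)
  have "dyadic ((-1/2 :: 'a) gchoose i)" for i
    using dyadic_gbinomial_half[of 0 i, where 'a='a] by simp
  then show ?case
    unfolding reflection_coeff.simps by (intro dyadic_sum dyadic_mult Suc dyadic_of_nat)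
qed

text \<open>Clearing the denominator of \<open>y\<close> costs only a power of two, which an odd divisor does not see.\<close>

lemma odd_dvd_of_dyadic_multiple:
  fixes T M d :: int
  assumes "of_int T = of_int M * (y :: 'a::field_char_0)" "dyadic y" "d dvd M" "odd d"
  shows "d dvd T"
proof -
  obtain e z where z: "2 ^ e * y = of_int z"
    using assms(2) unfolding dyadic_def Ints_def by blast
  have "(of_int (2 ^ e * T) :: 'a) = of_int M * (2 ^ e * y)"
    using assms(1) by simp
  also have "\<dots> = of_int (M * z)"
    by (simp add: z)
  finally have "2 ^ e * T = M * z"
    by (simp only: of_int_eq_iff)
  then have "d dvd 2 ^ e * T"
    using assms(3) by simp
  then show ?thesis
    using assms(4) by (simp add: coprime_dvd_mult_right_iff)
qed

section \<open>The congruence\<close>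

text \<open>
  This is \<open>sum_gbinomial_power\<close> at \<open>x = -1/2\<close>, where \<open>4 * k + 1 = -2 * (x - 2 * k)\<close> and the
  powers of \<open>-4\<close> in the summands combine with those in \<open>B k = (-4) ^ k * (x gchoose k)\<close> to
  one common factor.
\<close>

lemma central_binomial_sum_eq_dyadic_multiple:
  assumes "n \<ge> 1"
  shows "\<exists>y :: rat. dyadic y \<and>
    of_int (\<Sum>k=0..n-1. (4 * int k + 1) * int ((2 * k) choose k) ^ Suc r * (-4) ^ (Suc r * (n - 1 - k)))
      = of_int (int n * int ((2 * n) choose n)) * y"
proof -
  let ?x = "-1/2 :: rat"
  define z where "z = (\<Sum>j\<le>n. reflection_coeff ?x r j *
      (of_nat ((n - 1) choose j) * (?x - of_nat n gchoose j)))"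
  define y where "y = of_int (-2 * (-4) ^ (Suc r * (n - 1))) * (1 / (-4) ^ n) * z"
  have "dyadic z"
    unfolding z_def
    by (intro dyadic_sum dyadic_mult dyadic_reflection_coeff dyadic_of_nat dyadic_gbinomial_half)
  then have "dyadic y"
    unfolding y_def by (intro dyadic_mult dyadic_of_int dyadic_inverse_power_two)
  have summand: "of_int ((4 * int k + 1) * int ((2 * k) choose k) ^ Suc r * (-4) ^ (Suc r * (n - 1 - k)))
      = (-2) * (-4) ^ (Suc r * (n - 1)) * ((?x - 2 * of_nat k) * (?x gchoose k) ^ Suc r)"
    if "k < n" for k
  proof -
    have "(-4) ^ (Suc r * (n - 1 - k)) * ((-4) ^ k) ^ Suc r = ((-4) ^ (Suc r * (n - 1)) :: rat)"
    proof -
      have "Suc r * (n - 1 - k) + k * Suc r = Suc r * (n - 1)"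
        using that by (simp only: mult.commute[of k] distrib_left[symmetric]) simp
      then show ?thesis by (metis power_add power_mult)
    qed
    then have "((-4) ^ k * (?x gchoose k)) ^ Suc r * (-4) ^ (Suc r * (n - 1 - k)) =
        (-4) ^ (Suc r * (n - 1)) * (?x gchoose k) ^ Suc r"
      unfolding power_mult_distrib by (metis mult.assoc mult.commute)
    moreover have "4 * of_nat k + 1 = (-2) * (?x - 2 * of_nat k)"
      by simp
    moreover have "of_int ((4 * int k + 1) * int ((2 * k) choose k) ^ Suc r * (-4) ^ (Suc r * (n - 1 - k)))
        = (4 * of_nat k + 1) * (((-4) ^ k * (?x gchoose k)) ^ Suc r * (-4) ^ (Suc r * (n - 1 - k)))"
      unfolding central_binomial_conv_gbinomial[symmetric] by simp
    ultimately show ?thesis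
      by (simp only: mult_ac)
  qed
  have "of_int (\<Sum>k=0..n-1. (4 * int k + 1) * int ((2 * k) choose k) ^ Suc r * (-4) ^ (Suc r * (n - 1 - k)))
      = (\<Sum>k<n. (-2) * (-4) ^ (Suc r * (n - 1)) * ((?x - 2 * of_nat k) * (?x gchoose k) ^ Suc r))"
    unfolding of_int_sum using assms by (intro sum.cong summand) auto
  also have "\<dots> = (-2) * (-4) ^ (Suc r * (n - 1)) * (of_nat n * (?x gchoose n) * z)"
    by (simp only: sum_distrib_left[symmetric] sum_gbinomial_power z_def)
  also have "\<dots> = of_int (int n * int ((2 * n) choose n)) * y"
    by (simp add: y_def central_binomial_conv_gbinomial)
  finally show ?thesis using \<open>dyadic y\<close> by blast
qed

lemma power_two_dvd_central_binomial_sum: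
  assumes "2 ^ s dvd (2 * m) choose m"
  shows "2 ^ (s * \<rho>) dvd
    (\<Sum>k=0..m. (4 * int k + 1) * int ((2 * k) choose k) ^ \<rho> * (-4) ^ (\<rho> * (m - k)))"
proof (rule dvd_sum)
  fix k assume "k \<in> {0..m}"
  then have "2 ^ s dvd 2 ^ (m - k) * ((2 * k) choose k)"
    using power_two_dvd_central_binomial[OF assms] by simp
  then have "int (2 ^ s) dvd int (2 ^ (m - k) * ((2 * k) choose k))"
    by (simp only: of_nat_dvd_iff)
  then have "2 ^ s dvd 2 ^ (m - k) * int ((2 * k) choose k)"
    by simp
  moreover have "(-4 :: int) ^ (m - k) = 2 ^ (m - k) * (-2) ^ (m - k)"
    by (simp add: power_mult_distrib[symmetric])
  ultimately have "2 ^ s dvd int ((2 * k) choose k) * (-4) ^ (m - k)"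
    using dvd_mult2[of "2 ^ s" "2 ^ (m - k) * int ((2 * k) choose k)" "(-2) ^ (m - k)"]
    by (simp add: mult_ac)
  then have "(2 ^ s) ^ \<rho> dvd (int ((2 * k) choose k) * (-4) ^ (m - k)) ^ \<rho>"
    by (rule dvd_power_same)
  then have "2 ^ (s * \<rho>) dvd int ((2 * k) choose k) ^ \<rho> * (-4) ^ (\<rho> * (m - k))"
    by (simp add: power_mult power_mult_distrib mult.commute[of \<rho>])
  then show "2 ^ (s * \<rho>) dvd
      (4 * int k + 1) * int ((2 * k) choose k) ^ \<rho> * (-4) ^ (\<rho> * (m - k))"
    by (simp add: mult.assoc)
qed

theorem corollary1:
  fixes \<rho> n :: nat
  assumes "\<rho> \<ge> 2" and "n \<ge> 2"
  shows "[(\<Sum>k=0..n-1. (4 * int k + 1) * int ((2 * k) choose k) ^ \<rho> * (-4) ^ (\<rho> * (n - 1 - k))) = 0]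
           (mod (2 ^ (\<rho> - 2) * int n * int ((2 * n) choose n)))"
proof -
  define T where
    "T = (\<Sum>k=0..n-1. (4 * int k + 1) * int ((2 * k) choose k) ^ \<rho> * (-4) ^ (\<rho> * (n - 1 - k)))"
  define m where "m = n - 1"
  have n: "n = Suc m" and "m \<ge> 1"
    using assms(2) by (simp_all add: m_def)
  have "(2 * m) choose m \<noteq> 0"
    by simp
  moreover have "\<not> is_unit (2 :: nat)"
    by simp
  ultimately obtain u where "(2 * m) choose m = 2 ^ multiplicity 2 ((2 * m) choose m) * u" "odd u"
    by (rule multiplicity_decompose')
  then obtain s where u: "(2 * m) choose m = u * 2 ^ s" "odd u"
    by (metis mult.commute)
  have "even ((2 * m) choose m)"
    using central_binomial_Suc[of "m - 1"] \<open>m \<ge> 1\<close> by simp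
  then have "s \<ge> 1"
    using u by (cases s) auto
  define d where "d = int ((2 * m + 1) * u)"
  have "odd d"
    using u(2) by (simp add: d_def)
  have "n * ((2 * n) choose n) = 2 * (2 * m + 1) * (u * 2 ^ s)"
    using Suc_times_central_binomial[of m] by (simp only: n u(1))
  then have "int (n * ((2 * n) choose n)) = int (2 * (2 * m + 1) * (u * 2 ^ s))"
    by (rule arg_cong)
  then have nB: "int n * int ((2 * n) choose n) = 2 ^ Suc s * d"
    by (simp add: d_def algebra_simps)
  have "Suc (\<rho> - 1) = \<rho>"
    using assms(1) by simp
  then obtain y :: rat where y: "dyadic y"
      "of_int T = of_int (int n * int ((2 * n) choose n)) * y"
    using central_binomial_sum_eq_dyadic_multiple[of n "\<rho> - 1"] assms(2)
    unfolding T_def by auto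
  have "d dvd T"
    by (rule odd_dvd_of_dyadic_multiple[OF y(2,1) _ \<open>odd d\<close>]) (simp add: nB)
  have "2 ^ (s * \<rho>) dvd T"
    unfolding T_def m_def[symmetric]
    by (rule power_two_dvd_central_binomial_sum) (simp add: u(1))
  moreover have "\<rho> - 1 + s \<le> s * \<rho>"
  proof -
    \<comment> \<open>this is \<open>(s - 1) * (\<rho> - 1) \<ge> 0\<close>, rearranged\<close>
    obtain a b where "s = Suc a" "\<rho> = Suc b"
      using \<open>s \<ge> 1\<close> assms(1) by (metis Suc_le_D One_nat_def numeral_2_eq_2)
    then show ?thesis by simp
  qed
  ultimately have "2 ^ (\<rho> - 1 + s) dvd T"
    by (meson dvd_trans le_imp_power_dvd)
  then have "2 ^ (\<rho> - 1 + s) * d dvd T"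
    using \<open>d dvd T\<close> \<open>odd d\<close> by (intro divides_mult) simp_all
  moreover have "\<rho> - 1 + s = \<rho> - 2 + Suc s"
    using assms(1) by simp
  ultimately have "2 ^ (\<rho> - 2) * (int n * int ((2 * n) choose n)) dvd T"
    unfolding nB by (simp only: power_add mult.assoc)
  then show ?thesis
    unfolding T_def by (simp add: cong_0_iff mult.assoc)
qed

end
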